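(* Let $\mu\le\lambda$ be integer partitions and consider the interval $[\mu,\lambda]$ in Young's lattice. Let $n$ be the smallest integer such that $\mu\le\delta_n$. If $\delta_{n+1}\le\lambda$, then the lattice $[\mu,\lambda]$ is an Eeta win if and only if $\mathrm{path}(\lambda)$ does not contain an odd-length block of east steps immediately followed by an odd-length block of north steps.
   Context: Young's lattice is the lattice of integer partitions ordered by containment of Young diagrams. The staircase is $\delta_n=(n,n-1,\dots,1)$ for $n\ge 0$ ($\delta_0=\emptyset$). A lattice path is a finite word in $\mathrm{N}$ (unit north step) and $\mathrm{E}$ (unit east step); a block is a maximal consecutive string of equal steps. For $\lambda=(\lambda_1,\dots,\lambda_k)$ with $\lambda_1\ge\cdots\ge\lambda_k\ge1$, $\mathrm{path}(\lambda)=\mathrm{E}^{\lambda_k}\mathrm{N}\mathrm{E}^{\lambda_{k-1}-\lambda_k}\mathrm{N}\cdots\mathrm{E}^{\lambda_1-\lambda_2}\mathrm{N}$ (the southeast boundary of $\lambda$). Ungar game: for a finite lattice $L$ and $x\in L$, an Ungar move sends $x$ to $\bigwedge(\{x\}\cup T)$ with $T$ a subset of the elements covered by $x$; it is nontrivial if $T\ne\emptyset$. Starting at the top element $\hat1$, Atniss (first) and Eeta alternately make nontrivial Ungar moves; the player who cannot move (i.e. faces $\hat0$) loses. $L$ is an Atniss win if Atniss has a winning strategy, otherwise an Eeta win. *)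

theory Defs
  imports "HOL-Algebra.Lattice"
begin

section \<open>Young's lattice\<close>

definition is_partition :: "nat list \<Rightarrow> bool" where
  "is_partition lam \<longleftrightarrow> sorted_wrt (\<ge>) lam \<and> 0 \<notin> set lam"

definition young_diagram :: "nat list \<Rightarrow> (nat \<times> nat) set" where
  "young_diagram lam = {(i, j). i < length lam \<and> j < lam ! i}"

definition young_le :: "nat list \<Rightarrow> nat list \<Rightarrow> bool" (infix \<open>\<le>\<^sub>Y\<close> 50) where
  "\<mu> \<le>\<^sub>Y \<nu> \<longleftrightarrow> young_diagram \<mu> \<subseteq> young_diagram \<nu>"

definition young_interval :: "nat list \<Rightarrow> nat list \<Rightarrow> nat list gorder" where
  "young_interval \<mu> lam =
     \<lparr>carrier = {\<nu>. is_partition \<nu> \<and> \<mu> \<le>\<^sub>Y \<nu> \<and> \<nu> \<le>\<^sub>Y lam}, eq = (=), le = (\<le>\<^sub>Y)\<rparr>"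

definition staircase :: "nat \<Rightarrow> nat list" where
  "staircase n = rev [1..<Suc n]"

section \<open>Lattice paths\<close>

datatype step = North | East

fun boundary_path :: "nat list \<Rightarrow> step list" where
  "boundary_path [] = []"
| "boundary_path [a] = replicate a East @ [North]"
| "boundary_path (a # b # bs) = boundary_path (b # bs) @ replicate (a - b) East @ [North]"

text \<open>\<open>is_block us s m vs\<close>: in the word \<open>us @ replicate m s @ vs\<close>, the displayed middle
  factor is a block, that is, a maximal nonempty run of the letter \<open>s\<close>.\<close>

definition is_block :: "step list \<Rightarrow> step \<Rightarrow> nat \<Rightarrow> step list \<Rightarrow> bool" where
  "is_block us s m vs \<longleftrightarrow>
     m > 0 \<and> (us = [] \<or> last us \<noteq> s) \<and> (vs = [] \<or> hd vs \<noteq> s)"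

definition has_odd_east_odd_north :: "step list \<Rightarrow> bool" where
  "has_odd_east_odd_north w \<longleftrightarrow>
     (\<exists>us a b vs. w = us @ replicate a East @ replicate b North @ vs \<and>
        is_block us East a (replicate b North @ vs) \<and>
        is_block (us @ replicate a East) North b vs \<and>
        odd a \<and> odd b)"

section \<open>The Ungar game\<close>

definition covered_by :: "('a, 'b) gorder_scheme \<Rightarrow> 'a \<Rightarrow> 'a set" where
  "covered_by L x =
     {y \<in> carrier L. y \<sqsubset>\<^bsub>L\<^esub> x \<and> \<not> (\<exists>z \<in> carrier L. y \<sqsubset>\<^bsub>L\<^esub> z \<and> z \<sqsubset>\<^bsub>L\<^esub> x)}"

definition nontrivial_ungar_move :: "('a, 'b) gorder_scheme \<Rightarrow> 'a \<Rightarrow> 'a \<Rightarrow> bool" where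
  "nontrivial_ungar_move L x y \<longleftrightarrow>
     (\<exists>T. T \<subseteq> covered_by L x \<and> T \<noteq> {} \<and> y = \<Sqinter>\<^bsub>L\<^esub> ({x} \<union> T))"

text \<open>A (partial) play is the list of positions reached so far, starting with the top element.
  Atniss is to move exactly when this list has odd length.\<close>

definition ungar_play :: "('a, 'b) gorder_scheme \<Rightarrow> 'a list \<Rightarrow> bool" where
  "ungar_play L xs \<longleftrightarrow>
     xs \<noteq> [] \<and> hd xs = \<top>\<^bsub>L\<^esub> \<and> successively (nontrivial_ungar_move L) xs"

definition ungar_stuck :: "('a, 'b) gorder_scheme \<Rightarrow> 'a \<Rightarrow> bool" where
  "ungar_stuck L x \<longleftrightarrow> \<not> (\<exists>y. nontrivial_ungar_move L x y)"

definition atniss_follows :: "('a list \<Rightarrow> 'a) \<Rightarrow> 'a list \<Rightarrow> bool" where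
  "atniss_follows \<sigma> xs \<longleftrightarrow>
     (\<forall>i. Suc i < length xs \<and> odd (Suc i) \<longrightarrow> xs ! Suc i = \<sigma> (take (Suc i) xs))"

definition atniss_strategy :: "('a, 'b) gorder_scheme \<Rightarrow> ('a list \<Rightarrow> 'a) \<Rightarrow> bool" where
  "atniss_strategy L \<sigma> \<longleftrightarrow>
     (\<forall>xs. ungar_play L xs \<and> atniss_follows \<sigma> xs \<and> odd (length xs) \<and>
        \<not> ungar_stuck L (last xs) \<longrightarrow> nontrivial_ungar_move L (last xs) (\<sigma> xs))"

text \<open>Plays in a finite lattice terminate, since nontrivial moves strictly descend. Hence a strategy
  wins iff every completed play following it leaves Eeta (even length) without a move.\<close>

definition atniss_win :: "('a, 'b) gorder_scheme \<Rightarrow> bool" where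
  "atniss_win L \<longleftrightarrow>
     (\<exists>\<sigma>. atniss_strategy L \<sigma> \<and>
        (\<forall>xs. ungar_play L xs \<and> atniss_follows \<sigma> xs \<and> ungar_stuck L (last xs) \<longrightarrow>
           even (length xs)))"

definition eeta_win :: "('a, 'b) gorder_scheme \<Rightarrow> bool" where
  "eeta_win L \<longleftrightarrow> \<not> atniss_win L"

section \<open>Intervals of Young's lattice are finite lattices\<close>

definition row :: "nat list \<Rightarrow> nat \<Rightarrow> nat" where
  "row lam i = (if i < length lam then lam ! i else 0)"

lemma young_diagram_row: "young_diagram lam = {(i, j). j < row lam i}"
  by (auto simp: young_diagram_def row_def split: if_splits)

lemma young_le_row: "\<mu> \<le>\<^sub>Y \<nu> \<longleftrightarrow> (\<forall>i. row \<mu> i \<le> row \<nu> i)"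
proof
  assume *: "\<mu> \<le>\<^sub>Y \<nu>"
  show "\<forall>i. row \<mu> i \<le> row \<nu> i"
  proof (rule allI, rule ccontr)
    fix i assume "\<not> row \<mu> i \<le> row \<nu> i"
    then have "(i, row \<nu> i) \<in> young_diagram \<mu>" by (simp add: young_diagram_row)
    with * show False by (auto simp: young_le_def young_diagram_row)
  qed
qed (auto simp: young_le_def young_diagram_row intro: less_le_trans)

lemma row_pos_iff: "is_partition lam \<Longrightarrow> 0 < row lam i \<longleftrightarrow> i < length lam"
  by (metis is_partition_def not_gr_zero nth_mem row_def)

lemma row_antimono: "is_partition lam \<Longrightarrow> i \<le> j \<Longrightarrow> row lam j \<le> row lam i"
  by (auto simp: is_partition_def row_def sorted_wrt_iff_nth_less le_less)

lemma partition_eqI: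
  assumes "is_partition \<mu>" "is_partition \<nu>" "\<And>i. row \<mu> i = row \<nu> i"
  shows "\<mu> = \<nu>"
proof (rule nth_equalityI)
  show len: "length \<mu> = length \<nu>"
    using assms row_pos_iff by (metis linorder_neqE_nat less_irrefl)
  show "\<mu> ! i = \<nu> ! i" if "i < length \<mu>" for i
    using assms(3)[of i] that len by (simp add: row_def)
qed

lemma partition_of_rows:
  assumes anti: "\<And>i j. i \<le> j \<Longrightarrow> f j \<le> f i" and zero: "f k = (0::nat)"
  obtains \<nu> where "is_partition \<nu>" "\<And>i. row \<nu> i = f i"
proof
  define m where "m = (LEAST k. f k = 0)"
  have m: "f m = 0" unfolding m_def using zero by (rule LeastI)
  have pos: "i < m \<Longrightarrow> 0 < f i" for i unfolding m_def using not_less_Least by blast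
  show "is_partition (map f [0..<m])"
    using anti pos by (fastforce simp: is_partition_def sorted_wrt_iff_nth_less)
  show "row (map f [0..<m]) i = f i" for i
    using anti[of m i] m by (simp add: row_def)
qed

lemma young_interval_lattice:
  "lattice (young_interval \<mu> lam)"
proof -
  let ?L = "young_interval \<mu> lam"
  have antisym: "x = y" if "is_partition x" "is_partition y" "x \<le>\<^sub>Y y" "y \<le>\<^sub>Y x" for x y
    using that by (intro partition_eqI antisym) (auto simp: young_le_row)
  have po: "partial_order ?L"
    by unfold_locales (auto simp: young_interval_def young_le_def intro: antisym[unfolded young_le_def])
  have sup: "\<exists>s. least ?L s (Upper ?L {x, y})"
    if "x \<in> carrier ?L" "y \<in> carrier ?L" for x y
  proof -
    from that have p: "is_partition x" "is_partition y" by (auto simp: young_interval_def)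
    obtain \<nu> where \<nu>: "is_partition \<nu>" "\<And>i. row \<nu> i = max (row x i) (row y i)"
    proof (rule partition_of_rows)
      show "max (row x j) (row y j) \<le> max (row x i) (row y i)" if "i \<le> j" for i j
        using row_antimono[OF p(1) that] row_antimono[OF p(2) that] by linarith
      show "max (row x (length x + length y)) (row y (length x + length y)) = 0"
        by (simp add: row_def)
    qed blast
    have "least ?L \<nu> (Upper ?L {x, y})"
      using that \<nu> by (auto simp: least_def Upper_def young_interval_def young_le_row le_max_iff_disj)
    then show ?thesis ..
  qed
  have inf: "\<exists>s. greatest ?L s (Lower ?L {x, y})"
    if "x \<in> carrier ?L" "y \<in> carrier ?L" for x y
  proof -
    from that have p: "is_partition x" "is_partition y" by (auto simp: young_interval_def)
    obtain \<nu> where \<nu>: "is_partition \<nu>" "\<And>i. row \<nu> i = min (row x i) (row y i)"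
    proof (rule partition_of_rows)
      show "min (row x j) (row y j) \<le> min (row x i) (row y i)" if "i \<le> j" for i j
        using row_antimono[OF p(1) that] row_antimono[OF p(2) that] by linarith
      show "min (row x (length x)) (row y (length x)) = 0"
        by (simp add: row_def)
    qed blast
    have "greatest ?L \<nu> (Lower ?L {x, y})"
      using that \<nu>
      by (auto simp: greatest_def Lower_def young_interval_def young_le_row min_le_iff_disj)
    then show ?thesis ..
  qed
  interpret partial_order ?L by (rule po)
  show ?thesis by unfold_locales (fact sup inf)+
qed

lemma finite_young_interval: "finite (carrier (young_interval \<mu> lam))"
proof (rule finite_subset)
  show "carrier (young_interval \<mu> lam) \<subseteq>
      {\<nu>. set \<nu> \<subseteq> {..sum_list lam} \<and> length \<nu> \<le> length lam}"
  proof
    fix \<nu> assume "\<nu> \<in> carrier (young_interval \<mu> lam)"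
    then have p: "is_partition \<nu>" and le: "\<And>i. row \<nu> i \<le> row lam i"
      by (auto simp: young_interval_def young_le_row)
    have "length \<nu> \<le> length lam"
      using row_pos_iff[OF p, of "length lam"] le[of "length lam"] by (simp add: row_def)
    moreover have "\<nu> ! i \<le> sum_list lam" if "i < length \<nu>" for i
      using le[of i] that calculation elem_le_sum_list[of i lam] by (simp add: row_def)
    ultimately show "\<nu> \<in> {\<nu>. set \<nu> \<subseteq> {..sum_list lam} \<and> length \<nu> \<le> length lam}"
      by (auto simp: in_set_conv_nth)
  qed
qed (rule finite_lists_length_le, simp)

end

theory Submission
  imports Defs
begin

text \<open>
  Regard a partition \<open>\<nu>\<close> between \<open>\<mu>\<close> and \<open>\<lambda>\<close> as a lattice path; an Ungar move flips a nonempty set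
  of peaks EN into NE, where only peaks whose cell lies outside \<open>\<mu>\<close> may be flipped. Delete from the
  path of \<open>\<nu>\<close> all steps shared with the path of \<open>\<mu>\<close>. For arbitrary \<open>\<mu> \<le> \<lambda>\<close>, the player to move
  loses iff the remaining path has no odd run of E followed by an odd run of N. Indeed, if there is
  no such pair, take the leftmost flipped peak whose E-run is even: the run loses one E and is
  followed by a single N, so an odd pair appears (if all flipped peaks have odd E-runs, their N-runs
  are even, and the mirror image of this argument applies). Conversely, a set of flips that destroys
  all odd pairs is found by scanning the path from the left, keeping solutions for both possible
  parities of the N-run arriving from the right. The staircase hypothesis ensures that the paths of
  \<open>\<lambda>\<close> and \<open>\<mu>\<close> share no step.
\<close>

section \<open>Odd runs of lattice paths\<close>

text \<open>An infinite path is given by the set \<open>N\<close> of its north steps, where step \<open>t\<close> joins vertex \<open>t\<close>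
  to vertex \<open>t + 1\<close>. The set \<open>F\<close> of free vertices consists of those that are not on the path of
  \<open>\<mu>\<close>: an east step is shared with that path iff its end is not free, a north step iff its start
  is not free.\<close>

definition east_run :: "int set \<Rightarrow> int set \<Rightarrow> int \<Rightarrow> int set" where
  "east_run N F t = {s. s < t \<and> (\<forall>u\<in>{s..<t}. u \<notin> N \<and> u + 1 \<in> F)}"

definition north_run :: "int set \<Rightarrow> int set \<Rightarrow> int \<Rightarrow> int set" where
  "north_run N F t = {s. t \<le> s \<and> (\<forall>u\<in>{t..s}. u \<in> N \<and> u \<in> F)}"

definition odd_east_run :: "int set \<Rightarrow> int set \<Rightarrow> int \<Rightarrow> bool" where
  "odd_east_run N F t \<longleftrightarrow> odd (card (east_run N F t))"

definition odd_north_run :: "int set \<Rightarrow> int set \<Rightarrow> int \<Rightarrow> bool" where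
  "odd_north_run N F t \<longleftrightarrow> odd (card (north_run N F t))"

definition odd_odd_peak :: "int set \<Rightarrow> int set \<Rightarrow> int \<Rightarrow> bool" where
  "odd_odd_peak N F t \<longleftrightarrow> odd_east_run N F t \<and> odd_north_run N F t"

abbreviation has_odd_odd_peak :: "int set \<Rightarrow> int set \<Rightarrow> bool" where
  "has_odd_odd_peak N F \<equiv> \<exists>t. odd_odd_peak N F t"

lemma east_run_eq_interval:
  assumes "a \<le> b" "a - 1 \<in> N" "\<And>u. a \<le> u \<Longrightarrow> u < b \<Longrightarrow> u \<notin> N \<and> u + 1 \<in> F"
  shows "east_run N F b = {a..<b}"
proof (intro equalityI subsetI)
  fix s assume s: "s \<in> east_run N F b"
  then have "\<not> s \<le> a - 1"
    using assms(1,2) by (auto simp: east_run_def)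
  then show "s \<in> {a..<b}"
    using s by (auto simp: east_run_def)
qed (use assms(3) in \<open>auto simp: east_run_def\<close>)

lemma north_run_eq_interval:
  assumes "b \<notin> N" "a \<le> b" "\<And>u. a \<le> u \<Longrightarrow> u < b \<Longrightarrow> u \<in> N \<and> u \<in> F"
  shows "north_run N F a = {a..<b}"
proof (intro equalityI subsetI)
  fix s assume s: "s \<in> north_run N F a"
  then have "\<not> b \<le> s"
    using assms(1,2) by (auto simp: north_run_def)
  then show "s \<in> {a..<b}"
    using s by (auto simp: north_run_def)
qed (use assms(3) in \<open>auto simp: north_run_def\<close>)

lemma odd_east_run_step:
  assumes "finite F"
  shows "odd_east_run N F (t + 1) \<longleftrightarrow> t \<notin> N \<and> t + 1 \<in> F \<and> \<not> odd_east_run N F t"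
proof -
  have "east_run N F t \<subseteq> (\<lambda>s. s - 1) ` F"
    by (force simp: east_run_def image_iff)
  then have "finite (east_run N F t)"
    using assms finite_surj by blast
  moreover have "east_run N F (t + 1) =
      (if t \<notin> N \<and> t + 1 \<in> F then insert t (east_run N F t) else {})"
  proof -
    have "{s..<t + 1} = insert t {s..<t}" if "s \<le> t" for s :: int
      using that by auto
    then show ?thesis
      by (auto simp: east_run_def)
  qed
  moreover have "t \<notin> east_run N F t"
    by (simp add: east_run_def)
  ultimately show ?thesis
    by (simp add: odd_east_run_def)
qed

lemma odd_east_run_mem:
  assumes "finite F" "odd_east_run N F t"
  shows "t \<in> F"
  using odd_east_run_step[OF assms(1), of N "t - 1"] assms(2) by simp

text \<open>Reverses the path and exchanges its two kinds of steps, as conjugation of partitions does.\<close>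

definition mirror :: "int set \<Rightarrow> int set" where
  "mirror N = {t. - t - 1 \<notin> N}"

lemma mirror_mirror [simp]: "mirror (mirror N) = N"
  by (simp add: mirror_def)

lemma odd_north_run_mirror: "odd_north_run (mirror N) (uminus -` F) (- t) \<longleftrightarrow> odd_east_run N F t"
proof -
  have mem: "s \<in> north_run (mirror N) (uminus -` F) (- t) \<longleftrightarrow> - s - 1 \<in> east_run N F t" for s
  proof -
    have "{- s - 1..<t} = (\<lambda>u. - u - 1) ` {- t..s}"
      using image_diff_atLeastAtMost[of "- 1" "- t" s] by (auto simp: minus_diff_commute)
    then have "(\<forall>u\<in>{- s - 1..<t}. u \<notin> N \<and> u + 1 \<in> F) \<longleftrightarrow>
        (\<forall>u\<in>{- t..s}. - u - 1 \<notin> N \<and> - u \<in> F)"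
      by (simp only: ball_simps) simp
    moreover have "- t \<le> s \<longleftrightarrow> - s - 1 < t"
      by linarith
    ultimately show ?thesis
      by (simp add: east_run_def north_run_def mirror_def)
  qed
  have "north_run (mirror N) (uminus -` F) (- t) = (\<lambda>s. - s - 1) ` east_run N F t"
  proof (intro equalityI subsetI)
    fix s assume "s \<in> north_run (mirror N) (uminus -` F) (- t)"
    then show "s \<in> (\<lambda>s. - s - 1) ` east_run N F t"
      unfolding mem by (intro image_eqI[of _ _ "- s - 1"]) simp
  qed (auto simp: mem)
  then show ?thesis
    by (simp add: odd_east_run_def odd_north_run_def card_image inj_on_def)
qed

lemma odd_east_run_mirror: "odd_east_run (mirror N) (uminus -` F) (- t) \<longleftrightarrow> odd_north_run N F t"
  using odd_north_run_mirror[of "mirror N" "uminus -` F" "- t"] by (simp add: vimage_def)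

lemma odd_odd_peak_mirror: "odd_odd_peak (mirror N) (uminus -` F) (- t) \<longleftrightarrow> odd_odd_peak N F t"
  by (auto simp: odd_odd_peak_def odd_east_run_mirror odd_north_run_mirror)

lemma has_odd_odd_peak_mirror:
  "has_odd_odd_peak (mirror N) (uminus -` F) \<longleftrightarrow> has_odd_odd_peak N F"
  using odd_odd_peak_mirror by (metis minus_minus)

lemma odd_north_run_step:
  assumes "finite F"
  shows "odd_north_run N F t \<longleftrightarrow> t \<in> N \<and> t \<in> F \<and> \<not> odd_north_run N F (t + 1)"
proof -
  have "odd_north_run N F t \<longleftrightarrow> odd_east_run (mirror N) (uminus -` F) (- (t + 1) + 1)"
    by (simp add: odd_east_run_mirror)
  also have "\<dots> \<longleftrightarrow> t \<in> N \<and> t \<in> F \<and> \<not> odd_east_run (mirror N) (uminus -` F) (- (t + 1))"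
    using finite_vimageI[OF assms inj_uminus] by (subst odd_east_run_step) (auto simp: mirror_def)
  finally show ?thesis
    by (simp only: odd_east_run_mirror)
qed

section \<open>Flipping peaks\<close>

definition free_peaks :: "int set \<Rightarrow> int set \<Rightarrow> int set" where
  "free_peaks N F = {t \<in> N \<inter> F. t - 1 \<notin> N}"

definition flip_peaks :: "int set \<Rightarrow> int set \<Rightarrow> int set" where
  "flip_peaks N T = (N - T) \<union> (\<lambda>t. t - 1) ` T"

lemma mem_image_pred: "t \<in> (\<lambda>t. t - 1) ` A \<longleftrightarrow> t + 1 \<in> A" for t :: int
  by (force simp: image_iff)

lemma mem_flip_peaks: "t \<in> flip_peaks N T \<longleftrightarrow> t + 1 \<in> T \<or> t \<in> N \<and> t \<notin> T"
  by (auto simp: flip_peaks_def mem_image_pred)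

lemma flip_peaks_empty [simp]: "flip_peaks N {} = N"
  by (simp add: flip_peaks_def)

lemma finite_int_strictly_bounded:
  fixes A :: "int set"
  assumes "finite A"
  obtains a b where "A \<subseteq> {a<..<b}"
proof -
  obtain a b where "\<And>t. t \<in> A \<Longrightarrow> a \<le> t" "\<And>t. t \<in> A \<Longrightarrow> t \<le> b"
    using bdd_below_finite[OF assms] bdd_above_finite[OF assms] bdd_below.E bdd_above.E by metis
  then have "t \<in> {a - 1<..<b + 1}" if "t \<in> A" for t
    using that by fastforce
  then show ?thesis
    by (intro that[of "a - 1" "b + 1"]) blast
qed

locale peak_flip =
  fixes N F T F' :: "int set"
  assumes finite_free: "finite F"
    and peaks: "T \<subseteq> free_peaks N F"
    and unchanged_free: "F' - T = F - T"
begin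

abbreviation N' :: "int set" where
  "N' \<equiv> flip_peaks N T"

lemma peakD: "t \<in> T \<Longrightarrow> t \<in> N \<and> t \<in> F \<and> t - 1 \<notin> N"
  using peaks by (auto simp: free_peaks_def)

lemma finite_free': "finite F'"
proof (rule finite_subset)
  show "F' \<subseteq> F"
    using peakD unchanged_free by blast
qed (rule finite_free)

lemma mirror_flip: "flip_peaks (mirror N) (uminus -` T) = mirror N'"
proof (rule Set.set_eqI)
  fix t
  show "t \<in> flip_peaks (mirror N) (uminus -` T) \<longleftrightarrow> t \<in> mirror N'"
    using peakD[of "- t - 1"] peakD[of "- t"] by (auto simp: mem_flip_peaks mirror_def)
qed

lemma peak_flip_mirror: "peak_flip (mirror N) (uminus -` F) (uminus -` T) (uminus -` F')"
proof
  show "uminus -` T \<subseteq> free_peaks (mirror N) (uminus -` F)"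
    using peakD by (auto simp: free_peaks_def mirror_def)
  show "uminus -` F' - uminus -` T = uminus -` F - uminus -` T"
    using unchanged_free by auto
qed (use finite_free in \<open>simp_all add: finite_vimageI\<close>)

lemma odd_east_run_flip_step:
  assumes unchanged: "s \<notin> N \<Longrightarrow> odd_east_run N' F' s \<longleftrightarrow> odd_east_run N F s"
    and "s + 1 \<notin> N" and no_odd_north: "s \<in> T \<Longrightarrow> \<not> odd_north_run N F s"
  shows "odd_east_run N' F' (s + 1) \<longleftrightarrow> odd_east_run N F (s + 1)"
proof -
  have "s + 1 \<notin> T"
    using assms(2) peakD by blast
  then have same_vertex: "s + 1 \<in> F' \<longleftrightarrow> s + 1 \<in> F" and same_step: "s \<in> N' \<longleftrightarrow> s \<in> N \<and> s \<notin> T"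
    using unchanged_free by (auto simp: mem_flip_peaks)
  show ?thesis
  proof (cases "s \<in> N")
    case True
    have "s \<notin> T"
    proof
      assume "s \<in> T"
      moreover have "\<not> odd_north_run N F (s + 1)"
        using assms(2) odd_north_run_step finite_free by blast
      ultimately have "odd_north_run N F s"
        using peakD odd_north_run_step finite_free by blast
      then show False
        using no_odd_north \<open>s \<in> T\<close> by simp
    qed
    then show ?thesis
      using True same_step finite_free finite_free' by (simp add: odd_east_run_step)
  next
    case False
    then show ?thesis
      using unchanged same_step same_vertex finite_free finite_free'
      by (simp add: odd_east_run_step)
  qed
qed

lemma odd_east_run_flip:
  assumes "s \<notin> N" and "\<And>k. k \<in> T \<Longrightarrow> k < s \<Longrightarrow> \<not> odd_north_run N F k"
  shows "odd_east_run N' F' s \<longleftrightarrow> odd_east_run N F s"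
proof -
  obtain b c where "F \<union> F' \<subseteq> {b<..<c}"
    using finite_int_strictly_bounded[of "F \<union> F'"] finite_free finite_free' by auto
  then have "b < t" if "t \<in> F \<union> F'" for t
    using that by auto
  then have outside: "\<not> odd_east_run N F t \<and> \<not> odd_east_run N' F' t" if "t \<le> b" for t
    using that odd_east_run_mem[OF finite_free, of N t] odd_east_run_mem[OF finite_free', of N' t]
    by (meson UnI1 UnI2 leD)
  show ?thesis
  proof (cases "b \<le> s")
    case True
    then show ?thesis
      using assms
    proof (induction s rule: int_ge_induct)
      case base
      then show ?case
        using outside by simp
    next
      case (step s)
      then show ?case
        by (intro odd_east_run_flip_step) auto
    qed
  qed (use outside in simp)
qed

lemma has_odd_odd_peak_if_even_east_run:
  assumes no_peak: "\<not> has_odd_odd_peak N F" and "t \<in> T" "\<not> odd_east_run N F t"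
  shows "has_odd_odd_peak N' F'"
proof -
  define even_peaks where "even_peaks = {t \<in> T. \<not> odd_east_run N F t}"
  have even_peaks: "finite even_peaks" "even_peaks \<noteq> {}"
    using assms(2,3) peakD finite_free by (auto simp: even_peaks_def intro: finite_subset[of _ F])
  define m where "m = Min even_peaks"
  have m: "m \<in> T" "\<not> odd_east_run N F m"
    using Min_in[OF even_peaks] by (auto simp: even_peaks_def m_def)
  have least: "odd_east_run N F k" if "k \<in> T" "k < m" for k
    using that Min_le[OF even_peaks(1), of k] by (auto simp: even_peaks_def m_def)
  have before: "m - 1 \<notin> N" "odd_east_run N F (m - 1)"
    using m peakD[of m] odd_east_run_step[OF finite_free, of N "m - 1"] by auto
  then have "odd_east_run N' F' (m - 1)"
    using least no_peak by (subst odd_east_run_flip) (auto simp: odd_odd_peak_def)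
  moreover have "odd_north_run N' F' (m - 1)"
  proof -
    have "m - 1 \<in> F'"
      using before peakD unchanged_free odd_east_run_mem[OF finite_free] by blast
    moreover have "m - 1 \<in> N'" "m \<notin> N'"
      using m(1) peakD[of "m + 1"] peakD[of m] by (auto simp: mem_flip_peaks)
    ultimately show ?thesis
      using odd_north_run_step[OF finite_free', of N' m]
        odd_north_run_step[OF finite_free', of N' "m - 1"] by simp
  qed
  ultimately show ?thesis
    unfolding odd_odd_peak_def by blast
qed

lemma has_odd_odd_peak_flip:
  assumes "T \<noteq> {}" "\<not> has_odd_odd_peak N F"
  shows "has_odd_odd_peak N' F'"
proof -
  obtain t where t: "t \<in> T"
    using assms(1) by blast
  consider (even_east_run) "\<not> odd_east_run N F t" | (even_north_run) "\<not> odd_north_run N F t"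
    using assms(2) unfolding odd_odd_peak_def by blast
  then show ?thesis
  proof cases
    case even_east_run
    then show ?thesis
      using has_odd_odd_peak_if_even_east_run assms(2) t by blast
  next
    case even_north_run
    interpret mirror: peak_flip "mirror N" "uminus -` F" "uminus -` T" "uminus -` F'"
      by (rule peak_flip_mirror)
    have "has_odd_odd_peak (mirror N') (uminus -` F')"
      using mirror.has_odd_odd_peak_if_even_east_run[of "- t"] assms(2) t even_north_run
      by (simp add: has_odd_odd_peak_mirror odd_east_run_mirror mirror_flip)
    then show ?thesis
      by (simp only: has_odd_odd_peak_mirror)
  qed
qed

end

section \<open>Removing all odd peaks by flips\<close>

definition extends_flip :: "int set \<Rightarrow> int set \<Rightarrow> int set \<Rightarrow> int \<Rightarrow> int set \<Rightarrow> int set \<Rightarrow> bool" where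
  "extends_flip N F T m N' F' \<longleftrightarrow> finite F' \<and>
     (\<forall>t<m. t \<in> N' \<longleftrightarrow> t \<in> flip_peaks N T) \<and> (\<forall>t\<le>m. t \<notin> T \<longrightarrow> (t \<in> F' \<longleftrightarrow> t \<in> F))"

text \<open>After the flips \<open>T\<close> before vertex \<open>m\<close>, no odd pair remains before \<open>m\<close> and an odd east run
  ends at \<open>m\<close> iff \<open>v\<close>, however the path continues after \<open>m\<close>, provided that an odd north run starts
  at \<open>m\<close> iff \<open>r\<close>.\<close>

definition prefix_solution :: "int set \<Rightarrow> int set \<Rightarrow> int \<Rightarrow> bool \<Rightarrow> bool \<Rightarrow> int set \<Rightarrow> bool" where
  "prefix_solution N F m r v T \<longleftrightarrow> T \<subseteq> free_peaks N F \<inter> {..<m} \<and>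
     (\<forall>N' F'. extends_flip N F T m N' F' \<and> odd_north_run N' F' m = r \<longrightarrow>
        odd_east_run N' F' m = v \<and> (\<forall>t<m. \<not> odd_odd_peak N' F' t))"

abbreviation prefix_solvable :: "int set \<Rightarrow> int set \<Rightarrow> int \<Rightarrow> bool \<Rightarrow> bool \<Rightarrow> bool" where
  "prefix_solvable N F m r v \<equiv> \<exists>T. prefix_solution N F m r v T"

lemma prefix_solution_peaks: "prefix_solution N F m r v T \<Longrightarrow> T \<subseteq> free_peaks N F \<inter> {..<m}"
  by (simp add: prefix_solution_def)

lemma prefix_solutionD:
  assumes "prefix_solution N F m r v T" "extends_flip N F T m N' F'" "odd_north_run N' F' m = r"
  shows "odd_east_run N' F' m = v" and "t < m \<Longrightarrow> \<not> odd_odd_peak N' F' t"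
  using assms by (auto simp: prefix_solution_def)

lemma prefix_solution_below_free:
  assumes "F \<inter> {..m} = {}"
  shows "prefix_solution N F m r False {}"
proof -
  have "\<not> odd_east_run N' F' t" if "extends_flip N F {} m N' F'" "t \<le> m" for N' F' t
    using that assms odd_east_run_mem[of F' N' t] by (auto simp: extends_flip_def)
  then show ?thesis
    by (auto simp: prefix_solution_def odd_odd_peak_def)
qed

lemma prefix_solution_keep:
  assumes sol: "prefix_solution N F m (m \<in> N \<and> m \<in> F \<and> \<not> r) v T"
    and no_peak: "\<not> (v \<and> m \<in> N \<and> m \<in> F \<and> \<not> r)"
  shows "prefix_solution N F (m + 1) r (m \<notin> N \<and> m + 1 \<in> F \<and> \<not> v) T"
  unfolding prefix_solution_def
proof (intro conjI allI impI; (elim conjE)?)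
  note peaks = prefix_solution_peaks[OF sol]
  show "T \<subseteq> free_peaks N F \<inter> {..<m + 1}"
    using peaks by auto
  fix N' F'
  assume ext: "extends_flip N F T (m + 1) N' F'" and r: "odd_north_run N' F' (m + 1) = r"
  have "m \<notin> T" "m + 1 \<notin> T"
    using peaks by auto
  then have fin: "finite F'" and old: "extends_flip N F T m N' F'"
    and same: "m \<in> N' \<longleftrightarrow> m \<in> N" "m \<in> F' \<longleftrightarrow> m \<in> F" "m + 1 \<in> F' \<longleftrightarrow> m + 1 \<in> F"
    using ext by (auto simp: extends_flip_def mem_flip_peaks)
  have north: "odd_north_run N' F' m = (m \<in> N \<and> m \<in> F \<and> \<not> r)"
    using odd_north_run_step[OF fin, of N' m] r same by simp
  note before = prefix_solutionD[OF sol old north]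
  show "odd_east_run N' F' (m + 1) = (m \<notin> N \<and> m + 1 \<in> F \<and> \<not> v)"
    using odd_east_run_step[OF fin, of N' m] before(1) same by simp
  show "\<not> odd_odd_peak N' F' t" if "t < m + 1" for t
    using before north no_peak that by (cases "t = m") (auto simp: odd_odd_peak_def)
qed

lemma prefix_solution_flip:
  assumes sol: "prefix_solution N F m (m \<in> F) v T" and no_peak: "\<not> (v \<and> m \<in> F)"
    and peak: "m + 1 \<in> free_peaks N F"
  shows "prefix_solution N F (m + 2) r (m + 2 \<in> F) (insert (m + 1) T)"
  unfolding prefix_solution_def
proof (intro conjI allI impI; (elim conjE)?)
  note peaks = prefix_solution_peaks[OF sol]
  show "insert (m + 1) T \<subseteq> free_peaks N F \<inter> {..<m + 2}"
    using peaks peak by auto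
  fix N' F'
  assume ext: "extends_flip N F (insert (m + 1) T) (m + 2) N' F'"
  then have fin: "finite F'" and old: "extends_flip N F T m N' F'"
    by (auto simp: extends_flip_def mem_flip_peaks)
  have new: "t \<notin> T" if "m \<le> t" for t
    using peaks that by auto
  have flipped: "m \<in> N'" "m + 1 \<notin> N'" and same: "m \<in> F' \<longleftrightarrow> m \<in> F" "m + 2 \<in> F' \<longleftrightarrow> m + 2 \<in> F"
    using ext new by (auto simp: extends_flip_def mem_flip_peaks)
  have north_end: "\<not> odd_north_run N' F' (m + 1)"
    using odd_north_run_step[OF fin, of N' "m + 1"] flipped by simp
  then have north: "odd_north_run N' F' m = (m \<in> F)"
    using odd_north_run_step[OF fin, of N' m] flipped same by simp
  note before = prefix_solutionD[OF sol old north]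
  have "\<not> odd_east_run N' F' (m + 1)"
    using odd_east_run_step[OF fin, of N' m] flipped by simp
  then show "odd_east_run N' F' (m + 2) = (m + 2 \<in> F)"
    using odd_east_run_step[OF fin, of N' "m + 1"] flipped same by (simp add: add.commute[of 2])
  show "\<not> odd_odd_peak N' F' t" if t: "t < m + 2" for t
  proof -
    consider "t < m" | "t = m" | "t = m + 1"
      using t by linarith
    then show ?thesis
      using before north north_end no_peak by cases (auto simp: odd_odd_peak_def)
  qed
qed

text \<open>The last conjunct looks one step ahead because a flip spans two steps.\<close>

definition prefix_choices :: "int set \<Rightarrow> int set \<Rightarrow> int \<Rightarrow> bool" where
  "prefix_choices N F m \<longleftrightarrow> (\<exists>v. prefix_solvable N F m False v) \<and>
     (prefix_solvable N F m False True \<or> prefix_solvable N F m True False) \<and>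
     (m \<in> N \<inter> F \<longrightarrow> (\<exists>v. prefix_solvable N F (m + 1) False v))"

lemma prefix_solvable_north_step:
  assumes "m \<in> N \<inter> F" "prefix_solvable N F m True False"
  shows "prefix_solvable N F (m + 1) False False"
  using prefix_solution_keep[of N F m False False] assms by auto

lemma prefix_choices_north_step:
  assumes "prefix_choices N F m" "m \<in> N"
  shows "prefix_choices N F (m + 1)"
proof -
  obtain v where v: "prefix_solvable N F m False v"
    using assms(1) unfolding prefix_choices_def by blast
  have "prefix_solvable N F (m + 1) True False"
    using prefix_solution_keep[of N F m True v] v assms(2) by auto
  moreover have "\<exists>v. prefix_solvable N F (m + 1) False v"
    using assms prefix_solution_keep[of N F m False v] v
    by (cases "m \<in> F") (auto simp: prefix_choices_def)
  ultimately show ?thesis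
    unfolding prefix_choices_def using prefix_solvable_north_step[of "m + 1"] by blast
qed

lemma prefix_choices_east_step:
  assumes "prefix_choices N F m" "m \<notin> N"
  shows "prefix_choices N F (m + 1)"
proof -
  obtain v where v: "prefix_solvable N F m False v"
    using assms(1) unfolding prefix_choices_def by blast
  have east: "prefix_solvable N F (m + 1) r (m + 1 \<in> F \<and> \<not> u)"
    if "prefix_solvable N F m False u" for r u
    using prefix_solution_keep[of N F m r u] that assms(2) by auto
  have "\<exists>v. prefix_solvable N F (m + 1 + 1) False v" if peak: "m + 1 \<in> N \<inter> F"
  proof -
    consider (odd_run) "prefix_solvable N F m False True"
      | (even_run) "prefix_solvable N F m True False"
      using assms(1) unfolding prefix_choices_def by blast
    then show ?thesis
    proof cases
      case odd_run
      then show ?thesis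
        using east[of True True] prefix_solvable_north_step[OF peak] by auto
    next
      case even_run
      then obtain u where "prefix_solvable N F m (m \<in> F) u" "\<not> (u \<and> m \<in> F)"
        using v by (cases "m \<in> F") auto
      then have "prefix_solvable N F (m + 2) False (m + 2 \<in> F)"
        using prefix_solution_flip[of N F m u] peak assms(2) by (fastforce simp: free_peaks_def)
      then show ?thesis
        by (auto simp: add.assoc)
    qed
  qed
  moreover have "prefix_solvable N F (m + 1) False True \<or> prefix_solvable N F (m + 1) True False"
    using east[OF v, of True] east[OF v, of False] by (cases "m + 1 \<in> F \<and> \<not> v") simp_all
  ultimately show ?thesis
    unfolding prefix_choices_def using east[OF v, of False] by blast
qed

lemma ex_prefix_choices:
  assumes "finite F"
  obtains m where "F \<subseteq> {..<m}" "prefix_choices N F m"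
proof -
  obtain b c where "F \<subseteq> {b<..<c}"
    using finite_int_strictly_bounded[OF assms] .
  then have bounds: "F \<inter> {..b} = {}" "F \<subseteq> {..<max b c}"
    by auto
  have "prefix_choices N F m" if "b \<le> m" for m
    using that
  proof (induction m rule: int_ge_induct)
    case base
    have "prefix_solvable N F b r False" for r
      using prefix_solution_below_free[OF bounds(1)] by blast
    then show ?case
      unfolding prefix_choices_def using bounds(1) by blast
  next
    case (step m)
    then show ?case
      using prefix_choices_north_step prefix_choices_east_step by blast
  qed
  then show ?thesis
    using that[of "max b c"] bounds(2) by simp
qed

lemma ex_flip_without_odd_odd_peak:
  assumes "finite F"
  shows "\<exists>T\<subseteq>free_peaks N F. \<forall>F'. F' - T = F - T \<longrightarrow> \<not> has_odd_odd_peak (flip_peaks N T) F'"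
proof -
  obtain m where m: "F \<subseteq> {..<m}" "prefix_choices N F m"
    using ex_prefix_choices[OF assms] .
  then obtain v T where sol: "prefix_solution N F m False v T"
    unfolding prefix_choices_def by blast
  note peaks = prefix_solution_peaks[OF sol]
  show ?thesis
  proof (intro exI[of _ T] conjI allI impI)
    fix F' assume F': "F' - T = F - T"
    then interpret peak_flip N F T F'
      using assms peaks by unfold_locales auto
    have north_above: "\<not> odd_north_run N' F' t" if "m \<le> t" for t
    proof -
      have "t \<notin> F'"
        using m(1) F' peakD[of t] that by fastforce
      then show ?thesis
        using odd_north_run_step[OF finite_free', of N' t] by blast
    qed
    have "extends_flip N F T m N' F'"
      using finite_free' F' by (auto simp: extends_flip_def)
    note below = prefix_solutionD(2)[OF sol this]
    show "\<not> has_odd_odd_peak N' F'"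
    proof clarify
      fix t assume "odd_odd_peak N' F' t"
      then show False
        using below[of t] north_above[of m] north_above[of t]
        by (cases "t < m") (auto simp: odd_odd_peak_def)
    qed
  qed (use peaks in blast)
qed

section \<open>Kernels and winning strategies\<close>

definition ungar_kernel :: "('a, 'b) gorder_scheme \<Rightarrow> 'a set \<Rightarrow> bool" where
  "ungar_kernel L G \<longleftrightarrow>
     (\<forall>x\<in>carrier L \<inter> G. \<forall>y\<in>G. \<not> nontrivial_ungar_move L x y) \<and>
     (\<forall>x\<in>carrier L - G. \<exists>y\<in>G. nontrivial_ungar_move L x y)"

lemma (in lattice) nontrivial_ungar_move_descends:
  assumes "finite (carrier L)" "x \<in> carrier L" "nontrivial_ungar_move L x y"
  shows "y \<in> carrier L" and "y \<sqsubset> x"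
proof -
  obtain T where T: "T \<subseteq> covered_by L x" "T \<noteq> {}" "y = \<Sqinter>({x} \<union> T)"
    using assms(3) unfolding nontrivial_ungar_move_def by blast
  have carrier: "{x} \<union> T \<subseteq> carrier L"
    using assms(2) T(1) by (auto simp: covered_by_def)
  then have glb: "greatest L y (Lower L ({x} \<union> T))"
    unfolding T(3) using assms(1) by (intro finite_inf_greatest) (auto intro: finite_subset)
  then show y: "y \<in> carrier L"
    using greatest_closed by blast
  obtain z where z: "z \<in> T" "z \<in> carrier L" "z \<sqsubset> x"
    using T(1,2) unfolding covered_by_def by blast
  then have "y \<sqsubseteq> z"
    using greatest_Lower_below[OF glb _ carrier] by blast
  then show "y \<sqsubset> x"
    using z y assms(2) by (metis le_antisym le_trans lless_eq)
qed

lemma (in partial_order) wf_lless: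
  assumes "finite (carrier L)"
  shows "wf {(x, y). x \<in> carrier L \<and> y \<in> carrier L \<and> x \<sqsubset> y}"
proof (rule finite_acyclic_wf)
  let ?R = "{(x, y). x \<in> carrier L \<and> y \<in> carrier L \<and> x \<sqsubset> y}"
  show "finite ?R"
    using assms by (auto intro: finite_subset[of _ "carrier L \<times> carrier L"])
  have "trans ?R"
    using lless_trans by (blast intro: transI)
  moreover have "irrefl ?R"
    by (auto simp: irrefl_def lless_eq)
  ultimately show "acyclic ?R"
    by (simp add: acyclic_irrefl)
qed

lemma ungar_play_snoc:
  assumes "xs \<noteq> []"
  shows "ungar_play L (xs @ [y]) \<longleftrightarrow> ungar_play L xs \<and> nontrivial_ungar_move L (last xs) y"
  using assms by (auto simp: ungar_play_def successively_append_iff)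

lemma atniss_follows_snoc:
  "atniss_follows \<sigma> (xs @ [y]) \<longleftrightarrow> atniss_follows \<sigma> xs \<and> (odd (length xs) \<longrightarrow> y = \<sigma> xs)"
proof -
  have "atniss_follows \<sigma> (xs @ [y]) \<longleftrightarrow>
      (\<forall>j<Suc (length xs). odd j \<longrightarrow> (xs @ [y]) ! j = \<sigma> (take j (xs @ [y])))"
    unfolding atniss_follows_def by (auto elim: oddE)
  also have "\<dots> \<longleftrightarrow> (\<forall>j<length xs. odd j \<longrightarrow> xs ! j = \<sigma> (take j xs)) \<and> (odd (length xs) \<longrightarrow> y = \<sigma> xs)"
    by (auto simp: less_Suc_eq nth_append)
  also have "(\<forall>j<length xs. odd j \<longrightarrow> xs ! j = \<sigma> (take j xs)) \<longleftrightarrow> atniss_follows \<sigma> xs"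
    unfolding atniss_follows_def by (auto elim: oddE)
  finally show ?thesis .
qed

lemma (in lattice) atniss_loses_from_kernel:
  assumes fin: "finite (carrier L)" and kernel: "ungar_kernel L G"
    and strategy: "atniss_strategy L \<sigma>"
    and "ungar_play L xs" "atniss_follows \<sigma> xs" "odd (length xs)" "last xs \<in> carrier L \<inter> G"
  shows "\<exists>ys. ungar_play L ys \<and> atniss_follows \<sigma> ys \<and> odd (length ys) \<and> ungar_stuck L (last ys)"
  using assms(4-)
proof (induction "last xs" arbitrary: xs rule: wf_induct_rule[OF wf_lless[OF fin], case_names step])
  case (step xs)
  note xs = step.prems
  show ?case
  proof (cases "ungar_stuck L (last xs)")
    case True
    then show ?thesis
      using xs by blast
  next
    case False
    let ?y = "\<sigma> xs"
    have y: "nontrivial_ungar_move L (last xs) ?y"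
      using strategy False xs unfolding atniss_strategy_def by blast
    then have y_position: "?y \<in> carrier L - G" "?y \<sqsubset> last xs"
      using kernel xs nontrivial_ungar_move_descends[OF fin] unfolding ungar_kernel_def by blast+
    then obtain z where z: "z \<in> G" "nontrivial_ungar_move L ?y z"
      using kernel unfolding ungar_kernel_def by blast
    then have z_position: "z \<in> carrier L" "z \<sqsubset> ?y"
      using y_position nontrivial_ungar_move_descends[OF fin] by blast+
    then have "z \<sqsubset> last xs"
      using y_position xs lless_trans by blast
    moreover have "xs \<noteq> []"
      using xs by auto
    then have "ungar_play L (xs @ [?y])"
      using xs y by (simp add: ungar_play_snoc)
    then have "ungar_play L ((xs @ [?y]) @ [z])"
      using z(2) ungar_play_snoc[of "xs @ [?y]" L z] by simp
    moreover have "atniss_follows \<sigma> ((xs @ [?y]) @ [z])"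
      using xs unfolding atniss_follows_snoc by simp
    ultimately show ?thesis
      using step.hyps[of "(xs @ [?y]) @ [z]"] xs z z_position by simp
  qed
qed

lemma (in lattice) kernel_strategy_invariant:
  assumes fin: "finite (carrier L)" and kernel: "ungar_kernel L G" and top: "\<top> \<in> carrier L - G"
    and into_kernel: "\<And>xs. last xs \<in> carrier L - G \<Longrightarrow> \<sigma> xs \<in> G"
    and "ungar_play L xs" "atniss_follows \<sigma> xs"
  shows "last xs \<in> carrier L" and "odd (length xs) \<longleftrightarrow> last xs \<notin> G"
proof -
  from assms(5,6) have "last xs \<in> carrier L \<and> (odd (length xs) \<longleftrightarrow> last xs \<notin> G)"
  proof (induction xs rule: rev_induct)
    case Nil
    then show ?case
      by (simp add: ungar_play_def)
  next
    case (snoc x xs)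
    show ?case
    proof (cases "xs = []")
      case True
      then show ?thesis
        using snoc.prems(1) top by (simp add: ungar_play_def)
    next
      case False
      then have xs: "last xs \<in> carrier L" "odd (length xs) \<longleftrightarrow> last xs \<notin> G"
        and x: "nontrivial_ungar_move L (last xs) x" "odd (length xs) \<Longrightarrow> x = \<sigma> xs"
        using snoc by (auto simp: ungar_play_snoc atniss_follows_snoc)
      moreover have "x \<in> carrier L"
        using nontrivial_ungar_move_descends(1)[OF fin] xs(1) x(1) .
      ultimately show ?thesis
        using into_kernel[of xs] kernel by (auto simp: ungar_kernel_def)
    qed
  qed
  then show "last xs \<in> carrier L" and "odd (length xs) \<longleftrightarrow> last xs \<notin> G"
    by auto
qed

lemma (in lattice) atniss_win_iff_top_notin_kernel:
  assumes fin: "finite (carrier L)" and top: "\<top> \<in> carrier L" and kernel: "ungar_kernel L G"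
  shows "atniss_win L \<longleftrightarrow> \<top> \<notin> G"
proof
  assume "atniss_win L"
  then obtain \<sigma> where "atniss_strategy L \<sigma>"
    and "\<And>xs. ungar_play L xs \<Longrightarrow> atniss_follows \<sigma> xs \<Longrightarrow> ungar_stuck L (last xs) \<Longrightarrow> even (length xs)"
    unfolding atniss_win_def by blast
  moreover have "ungar_play L [\<top>]" "atniss_follows \<sigma> [\<top>]"
    by (simp_all add: ungar_play_def atniss_follows_def)
  ultimately show "\<top> \<notin> G"
    using atniss_loses_from_kernel[OF fin kernel, of \<sigma> "[\<top>]"] top by auto
next
  assume "\<top> \<notin> G"
  obtain f where f: "\<And>x. x \<in> carrier L - G \<Longrightarrow> f x \<in> G \<and> nontrivial_ungar_move L x (f x)"
    using kernel unfolding ungar_kernel_def by metis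
  define \<sigma> where "\<sigma> xs = f (last xs)" for xs
  note invariant = kernel_strategy_invariant[OF fin kernel, of \<sigma>]
  show "atniss_win L"
    unfolding atniss_win_def atniss_strategy_def
  proof (intro exI[of _ \<sigma>] conjI allI impI; elim conjE)
    fix xs
    assume "ungar_play L xs" "atniss_follows \<sigma> xs"
    then have xs: "last xs \<in> carrier L" "odd (length xs) \<longleftrightarrow> last xs \<notin> G"
      using invariant top \<open>\<top> \<notin> G\<close> f by (auto simp: \<sigma>_def)
    show "nontrivial_ungar_move L (last xs) (\<sigma> xs)" if "odd (length xs)"
      using xs f that by (simp add: \<sigma>_def)
    show "even (length xs)" if "ungar_stuck L (last xs)"
      using xs f that unfolding ungar_stuck_def by blast
  qed
qed

section \<open>Moves in an interval of Young's lattice\<close>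

definition removable_rows :: "nat list \<Rightarrow> nat list \<Rightarrow> nat set" where
  "removable_rows \<mu> \<nu> = {i. row \<nu> (Suc i) < row \<nu> i \<and> row \<mu> i < row \<nu> i}"

text \<open>Unspecified unless the rows \<open>R\<close> can be shortened simultaneously.\<close>

definition remove_cells :: "nat list \<Rightarrow> nat set \<Rightarrow> nat list" where
  "remove_cells \<nu> R = (THE \<nu>'. is_partition \<nu>' \<and> (\<forall>i. row \<nu>' i = row \<nu> i - of_bool (i \<in> R)))"

lemma remove_cells:
  assumes "is_partition \<nu>" "R \<subseteq> removable_rows \<mu> \<nu>"
  shows is_partition_remove_cells: "is_partition (remove_cells \<nu> R)"
    and row_remove_cells: "row (remove_cells \<nu> R) i = row \<nu> i - of_bool (i \<in> R)"
proof -
  let ?f = "\<lambda>i. row \<nu> i - of_bool (i \<in> R)"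
  have "?f j \<le> ?f i" if "i \<le> j" for i j
  proof (cases "i = j")
    case False
    then have "row \<nu> j \<le> row \<nu> (Suc i)" "row \<nu> j \<le> row \<nu> i"
      using row_antimono[OF assms(1)] that by auto
    moreover have "row \<nu> (Suc i) < row \<nu> i" if "i \<in> R"
      using assms(2) that by (auto simp: removable_rows_def)
    ultimately show ?thesis
      by auto
  qed simp
  moreover have "?f (length \<nu>) = 0"
    by (simp add: row_def)
  ultimately obtain \<nu>' where \<nu>': "is_partition \<nu>'" "\<And>i. row \<nu>' i = ?f i"
    using partition_of_rows[of ?f] by blast
  then have "\<exists>!\<nu>'. is_partition \<nu>' \<and> (\<forall>i. row \<nu>' i = ?f i)"
    by (intro ex1I[of _ \<nu>']) (auto intro: partition_eqI)
  then have "is_partition (remove_cells \<nu> R) \<and> (\<forall>i. row (remove_cells \<nu> R) i = ?f i)"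
    unfolding remove_cells_def by (rule theI')
  then show "is_partition (remove_cells \<nu> R)" and "row (remove_cells \<nu> R) i = ?f i"
    by auto
qed

lemma carrier_young_interval:
  "\<nu> \<in> carrier (young_interval \<mu> lam) \<longleftrightarrow> is_partition \<nu> \<and> \<mu> \<le>\<^sub>Y \<nu> \<and> \<nu> \<le>\<^sub>Y lam"
  by (simp add: young_interval_def)

lemma le_young_interval: "x \<sqsubseteq>\<^bsub>young_interval \<mu> lam\<^esub> y \<longleftrightarrow> x \<le>\<^sub>Y y"
  by (simp add: young_interval_def)

lemma lless_young_interval: "x \<sqsubset>\<^bsub>young_interval \<mu> lam\<^esub> y \<longleftrightarrow> x \<le>\<^sub>Y y \<and> x \<noteq> y"
  by (simp add: lless_def young_interval_def)

lemma young_le_antisym: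
  assumes "is_partition x" "is_partition y" "x \<le>\<^sub>Y y" "y \<le>\<^sub>Y x"
  shows "x = y"
  using assms by (intro partition_eqI) (auto simp: young_le_row intro: order.antisym)

lemma young_le_trans: "x \<le>\<^sub>Y y \<Longrightarrow> y \<le>\<^sub>Y z \<Longrightarrow> x \<le>\<^sub>Y z"
  by (auto simp: young_le_def)

lemma top_young_interval:
  assumes "is_partition lam" "\<mu> \<le>\<^sub>Y lam"
  shows "\<top>\<^bsub>young_interval \<mu> lam\<^esub> = lam"
proof -
  interpret lattice "young_interval \<mu> lam"
    by (rule young_interval_lattice)
  have "greatest (young_interval \<mu> lam) lam (carrier (young_interval \<mu> lam))"
    using assms by (auto simp: greatest_def young_interval_def young_le_def)
  then show ?thesis
    unfolding top_def by (blast intro: some_equality greatest_unique)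
qed

lemma remove_cells_empty [simp]:
  assumes "is_partition \<nu>"
  shows "remove_cells \<nu> {} = \<nu>"
  using assms remove_cells[OF assms, of "{}"] by (auto intro: partition_eqI)

lemma remove_cells_le_iff:
  assumes "is_partition \<nu>" "R \<subseteq> removable_rows \<mu> \<nu>" "R' \<subseteq> removable_rows \<mu> \<nu>"
  shows "remove_cells \<nu> R \<le>\<^sub>Y remove_cells \<nu> R' \<longleftrightarrow> R' \<subseteq> R"
proof -
  have "row \<nu> i - of_bool (i \<in> R) \<le> row \<nu> i - of_bool (i \<in> R') \<longleftrightarrow> (i \<in> R' \<longrightarrow> i \<in> R)" for i
    using assms(3) by (cases "i \<in> R") (auto simp: removable_rows_def)
  then show ?thesis
    using row_remove_cells[OF assms(1,2)] row_remove_cells[OF assms(1,3)]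
    by (auto simp: young_le_row subset_iff)
qed

lemma remove_cells_young_interval:
  assumes "\<nu> \<in> carrier (young_interval \<mu> lam)" "R \<subseteq> removable_rows \<mu> \<nu>"
  shows "remove_cells \<nu> R \<in> carrier (young_interval \<mu> lam)"
proof -
  have \<nu>: "is_partition \<nu>" "\<And>i. row \<mu> i \<le> row \<nu> i" "\<And>i. row \<nu> i \<le> row lam i"
    using assms(1) by (auto simp: carrier_young_interval young_le_row)
  have "row \<mu> i \<le> row \<nu> i - of_bool (i \<in> R)" for i
    using \<nu>(2)[of i] assms(2) by (auto simp: removable_rows_def)
  then show ?thesis
    using \<nu> is_partition_remove_cells[OF \<nu>(1) assms(2)] le_trans[OF diff_le_self \<nu>(3)]
    by (auto simp: carrier_young_interval young_le_row row_remove_cells[OF \<nu>(1) assms(2)])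
qed

lemma remove_cell_lless:
  assumes "is_partition \<nu>" "i \<in> removable_rows \<mu> \<nu>"
  shows "remove_cells \<nu> {i} \<sqsubset>\<^bsub>young_interval \<mu> lam\<^esub> \<nu>"
  using assms remove_cells_le_iff[OF assms(1), of "{i}" \<mu> "{}"]
    remove_cells_le_iff[OF assms(1), of "{}" \<mu> "{i}"] by (auto simp: lless_young_interval)

lemma lless_le_remove_cell:
  assumes x: "x \<in> carrier (young_interval \<mu> lam)" and \<nu>: "is_partition \<nu>"
    and less: "x \<sqsubset>\<^bsub>young_interval \<mu> lam\<^esub> \<nu>"
  obtains i where "i \<in> removable_rows \<mu> \<nu>" "x \<le>\<^sub>Y remove_cells \<nu> {i}"
proof -
  let ?D = "{i. row x i < row \<nu> i}"
  have part: "is_partition x" and le: "row \<mu> i \<le> row x i" "row x i \<le> row \<nu> i" for i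
    using x less by (auto simp: carrier_young_interval lless_young_interval young_le_row)
  have "?D \<subseteq> {..<length \<nu>}"
    by (auto simp: row_def split: if_splits)
  then have fin: "finite ?D"
    by (rule finite_subset) simp
  have "?D \<noteq> {}"
    using le(2) part \<nu> less partition_eqI[of x \<nu>]
    by (auto simp: lless_young_interval order.order_iff_strict)
  define i where "i = Max ?D"
  have i: "row x i < row \<nu> i"
    using Max_in[OF fin \<open>?D \<noteq> {}\<close>] by (simp add: i_def)
  have "Suc i \<notin> ?D"
    using Max_ge[OF fin, of "Suc i"] by (auto simp: i_def)
  then have "row \<nu> (Suc i) \<le> row x (Suc i)"
    by simp
  also have "\<dots> \<le> row x i"
    using part row_antimono by simp
  finally have removable: "i \<in> removable_rows \<mu> \<nu>"
    using i le(1)[of i] by (simp add: removable_rows_def)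
  moreover have "row x k \<le> row \<nu> k - of_bool (k \<in> {i})" for k
    using le(2)[of k] i by auto
  then have "x \<le>\<^sub>Y remove_cells \<nu> {i}"
    using row_remove_cells[OF \<nu>, of "{i}"] removable by (simp add: young_le_row)
  ultimately show ?thesis
    by (rule that)
qed

lemma covered_by_young_interval:
  assumes "\<nu> \<in> carrier (young_interval \<mu> lam)"
  shows "covered_by (young_interval \<mu> lam) \<nu> = (\<lambda>i. remove_cells \<nu> {i}) ` removable_rows \<mu> \<nu>"
    (is "covered_by ?L \<nu> = ?remove ` _")
proof (intro equalityI subsetI)
  have \<nu>: "is_partition \<nu>"
    using assms by (simp add: carrier_young_interval)
  have remove: "?remove i \<in> carrier ?L" "?remove i \<sqsubset>\<^bsub>?L\<^esub> \<nu>" if "i \<in> removable_rows \<mu> \<nu>" for i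
    using that remove_cells_young_interval[OF assms, of "{i}"] remove_cell_lless[OF \<nu>] by simp_all
  {
    fix y assume y: "y \<in> covered_by ?L \<nu>"
    then obtain i where i: "i \<in> removable_rows \<mu> \<nu>" "y \<le>\<^sub>Y ?remove i"
      using lless_le_remove_cell[OF _ \<nu>] unfolding covered_by_def by blast
    then have "y = ?remove i"
      using y remove[OF i(1)] unfolding covered_by_def lless_young_interval by blast
    then show "y \<in> ?remove ` removable_rows \<mu> \<nu>"
      using i by blast
  next
    fix y assume "y \<in> ?remove ` removable_rows \<mu> \<nu>"
    then obtain i where i: "i \<in> removable_rows \<mu> \<nu>" and y: "y = ?remove i"
      by blast
    have False if z: "z \<in> carrier ?L" "y \<sqsubset>\<^bsub>?L\<^esub> z" "z \<sqsubset>\<^bsub>?L\<^esub> \<nu>" for z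
    proof -
      obtain j where j: "j \<in> removable_rows \<mu> \<nu>" "z \<le>\<^sub>Y ?remove j"
        using lless_le_remove_cell[OF z(1) \<nu> z(3)] .
      then have "?remove i \<le>\<^sub>Y ?remove j"
        using z(2) y young_le_trans by (auto simp: lless_young_interval)
      then have "j = i"
        using remove_cells_le_iff[OF \<nu>, of "{i}" \<mu> "{j}"] i j by simp
      then show False
        using young_le_antisym[of z y] z j y remove(1)[OF i]
        by (auto simp: lless_young_interval carrier_young_interval)
    qed
    then show "y \<in> covered_by ?L \<nu>"
      using remove[OF i] y unfolding covered_by_def by blast
  }
qed

lemma inf_remove_cells:
  assumes \<nu>: "\<nu> \<in> carrier (young_interval \<mu> lam)" and R: "R \<subseteq> removable_rows \<mu> \<nu>"
  shows "\<Sqinter>\<^bsub>young_interval \<mu> lam\<^esub> ({\<nu>} \<union> (\<lambda>i. remove_cells \<nu> {i}) ` R) = remove_cells \<nu> R"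
    (is "\<Sqinter>\<^bsub>?L\<^esub> ?A = _")
proof -
  interpret lattice ?L
    by (rule young_interval_lattice)
  have part: "is_partition \<nu>"
    using \<nu> by (simp add: carrier_young_interval)
  have sub: "{i} \<subseteq> removable_rows \<mu> \<nu>" if "i \<in> R" for i
    using R that by blast
  have "greatest ?L (remove_cells \<nu> R) (Lower ?L ?A)"
  proof (rule greatest_LowerI)
    show "?A \<subseteq> carrier ?L"
      using \<nu> remove_cells_young_interval[OF \<nu> sub] by auto
    show "remove_cells \<nu> R \<in> carrier ?L"
      by (rule remove_cells_young_interval[OF \<nu> R])
    show "remove_cells \<nu> R \<sqsubseteq>\<^bsub>?L\<^esub> x" if "x \<in> ?A" for x
      using that remove_cells_le_iff[OF part R, of "{}"] remove_cells_le_iff[OF part R sub] part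
      by (auto simp: le_young_interval)
    fix z assume "z \<in> Lower ?L ?A"
    then have z: "z \<le>\<^sub>Y \<nu>" "\<And>i. i \<in> R \<Longrightarrow> z \<le>\<^sub>Y remove_cells \<nu> {i}"
      using \<nu> remove_cells_young_interval[OF \<nu> sub] by (auto simp: Lower_def le_young_interval)
    have "row z i \<le> row \<nu> i - of_bool (i \<in> R)" for i
    proof (cases "i \<in> R")
      case True
      then show ?thesis
        using z(2)[OF True, unfolded young_le_row, rule_format, of i]
          row_remove_cells[OF part sub[OF True], of i] by simp
    qed (use z(1) in \<open>simp add: young_le_row\<close>)
    then show "z \<sqsubseteq>\<^bsub>?L\<^esub> remove_cells \<nu> R"
      by (simp add: le_young_interval young_le_row row_remove_cells[OF part R])
  qed
  then show ?thesis
    unfolding inf_def by (blast intro: some_equality greatest_unique)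
qed

lemma nontrivial_ungar_move_young_interval:
  assumes "\<nu> \<in> carrier (young_interval \<mu> lam)"
  shows "nontrivial_ungar_move (young_interval \<mu> lam) \<nu> \<nu>' \<longleftrightarrow>
    (\<exists>R\<subseteq>removable_rows \<mu> \<nu>. R \<noteq> {} \<and> \<nu>' = remove_cells \<nu> R)"
  unfolding nontrivial_ungar_move_def covered_by_young_interval[OF assms]
proof
  assume "\<exists>T\<subseteq>(\<lambda>i. remove_cells \<nu> {i}) ` removable_rows \<mu> \<nu>.
    T \<noteq> {} \<and> \<nu>' = \<Sqinter>\<^bsub>young_interval \<mu> lam\<^esub> ({\<nu>} \<union> T)"
  then obtain R where "R \<subseteq> removable_rows \<mu> \<nu>" "R \<noteq> {}"
    "\<nu>' = \<Sqinter>\<^bsub>young_interval \<mu> lam\<^esub> ({\<nu>} \<union> (\<lambda>i. remove_cells \<nu> {i}) ` R)"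
    by (auto simp: subset_image_iff)
  then show "\<exists>R\<subseteq>removable_rows \<mu> \<nu>. R \<noteq> {} \<and> \<nu>' = remove_cells \<nu> R"
    using inf_remove_cells[OF assms] by blast
next
  assume "\<exists>R\<subseteq>removable_rows \<mu> \<nu>. R \<noteq> {} \<and> \<nu>' = remove_cells \<nu> R"
  then obtain R where "R \<subseteq> removable_rows \<mu> \<nu>" "R \<noteq> {}" "\<nu>' = remove_cells \<nu> R"
    by blast
  then show "\<exists>T\<subseteq>(\<lambda>i. remove_cells \<nu> {i}) ` removable_rows \<mu> \<nu>.
    T \<noteq> {} \<and> \<nu>' = \<Sqinter>\<^bsub>young_interval \<mu> lam\<^esub> ({\<nu>} \<union> T)"
    using inf_remove_cells[OF assms, of R]
    by (intro exI[of _ "(\<lambda>i. remove_cells \<nu> {i}) ` R"]) auto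
qed

section \<open>Partitions as lattice paths\<close>

text \<open>Vertex \<open>t\<close> of the path of \<open>\<nu>\<close> lies on the diagonal of cells of content \<open>t\<close>, so the position of
  the north step of row \<open>i\<close> is the content of the last cell of that row.\<close>

definition north_step :: "nat list \<Rightarrow> nat \<Rightarrow> int" where
  "north_step \<nu> i = int (row \<nu> i) - int i - 1"

definition north_steps :: "nat list \<Rightarrow> int set" where
  "north_steps \<nu> = range (north_step \<nu>)"

definition skew_contents :: "nat list \<Rightarrow> nat list \<Rightarrow> int set" where
  "skew_contents \<mu> \<nu> = (\<lambda>(i, j). int j - int i) ` (young_diagram \<nu> - young_diagram \<mu>)"

lemma finite_skew_contents: "finite (skew_contents \<mu> \<nu>)"
proof -
  have "young_diagram \<nu> = (SIGMA i:{..<length \<nu>}. {..<\<nu> ! i})"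
    by (auto simp: young_diagram_def)
  then show ?thesis
    by (simp add: skew_contents_def)
qed

lemma mem_skew_contents:
  "t \<in> skew_contents \<mu> \<nu> \<longleftrightarrow> (\<exists>i. int (row \<mu> i) \<le> t + int i \<and> t + int i < int (row \<nu> i))"
proof
  assume "\<exists>i. int (row \<mu> i) \<le> t + int i \<and> t + int i < int (row \<nu> i)"
  then obtain i where i: "int (row \<mu> i) \<le> t + int i" "t + int i < int (row \<nu> i)"
    by blast
  then have "(i, nat (t + int i)) \<in> young_diagram \<nu> - young_diagram \<mu>"
    by (auto simp: young_diagram_row)
  moreover have "t = int (nat (t + int i)) - int i"
    using i(1) by simp
  ultimately show "t \<in> skew_contents \<mu> \<nu>"
    unfolding skew_contents_def by (intro image_eqI[of _ _ "(i, nat (t + int i))"]) auto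
next
  assume "t \<in> skew_contents \<mu> \<nu>"
  then obtain i j where "t = int j - int i" "j < row \<nu> i" "\<not> j < row \<mu> i"
    by (auto simp: skew_contents_def young_diagram_row)
  then show "\<exists>i. int (row \<mu> i) \<le> t + int i \<and> t + int i < int (row \<nu> i)"
    by (intro exI[of _ i]) simp
qed

lemma north_step_less_iff:
  assumes "is_partition \<nu>"
  shows "north_step \<nu> i < north_step \<nu> j \<longleftrightarrow> j < i"
  using row_antimono[OF assms, of i j] row_antimono[OF assms, of j i]
  by (cases i j rule: linorder_cases) (auto simp: north_step_def)

lemma inj_north_step: "is_partition \<nu> \<Longrightarrow> inj (north_step \<nu>)"
  using north_step_less_iff by (metis injI linorder_neqE_nat less_irrefl)

lemma pred_north_step_mem_iff:
  assumes "is_partition \<nu>"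
  shows "north_step \<nu> i - 1 \<in> north_steps \<nu> \<longleftrightarrow> row \<nu> (Suc i) = row \<nu> i"
proof
  assume "north_step \<nu> i - 1 \<in> north_steps \<nu>"
  then obtain j where j: "north_step \<nu> j = north_step \<nu> i - 1"
    by (auto simp: north_steps_def)
  then have "i < j"
    using north_step_less_iff[OF assms, of j i] by simp
  then have "row \<nu> j \<le> row \<nu> (Suc i)" "row \<nu> (Suc i) \<le> row \<nu> i"
    using row_antimono[OF assms] by simp_all
  then show "row \<nu> (Suc i) = row \<nu> i"
    using j \<open>i < j\<close> by (simp add: north_step_def)
next
  assume "row \<nu> (Suc i) = row \<nu> i"
  then have "north_step \<nu> i - 1 = north_step \<nu> (Suc i)"
    by (simp add: north_step_def)
  then show "north_step \<nu> i - 1 \<in> north_steps \<nu>"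
    by (simp add: north_steps_def)
qed

lemma north_step_mem_skew_contents_iff:
  assumes "is_partition \<mu>" "is_partition \<nu>"
  shows "north_step \<nu> i \<in> skew_contents \<mu> \<nu> \<longleftrightarrow> row \<mu> i < row \<nu> i"
proof
  assume "north_step \<nu> i \<in> skew_contents \<mu> \<nu>"
  then obtain j where j: "int (row \<mu> j) \<le> north_step \<nu> i + int j" "north_step \<nu> i \<le> north_step \<nu> j"
    by (auto simp: mem_skew_contents north_step_def)
  then have "j \<le> i"
    using north_step_less_iff[OF assms(2), of j i] by linarith
  then show "row \<mu> i < row \<nu> i"
    using row_antimono[OF assms(1), of j i] j(1) by (simp add: north_step_def)
next
  assume "row \<mu> i < row \<nu> i"
  then show "north_step \<nu> i \<in> skew_contents \<mu> \<nu>"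
    unfolding mem_skew_contents by (intro exI[of _ i]) (simp add: north_step_def)
qed

lemma free_peaks_north_steps:
  assumes "is_partition \<mu>" "is_partition \<nu>"
  shows "free_peaks (north_steps \<nu>) (skew_contents \<mu> \<nu>) = north_step \<nu> ` removable_rows \<mu> \<nu>"
proof -
  have "north_step \<nu> i \<in> free_peaks (north_steps \<nu>) (skew_contents \<mu> \<nu>) \<longleftrightarrow>
      i \<in> removable_rows \<mu> \<nu>" for i
  proof -
    have "north_step \<nu> i \<in> north_steps \<nu>"
      by (simp add: north_steps_def)
    then show ?thesis
      using row_antimono[OF assms(2), of i "Suc i"]
      by (auto simp: free_peaks_def removable_rows_def pred_north_step_mem_iff[OF assms(2)]
          north_step_mem_skew_contents_iff[OF assms])
  qed
  moreover have "free_peaks (north_steps \<nu>) (skew_contents \<mu> \<nu>) \<subseteq> range (north_step \<nu>)"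
    by (auto simp: free_peaks_def north_steps_def)
  ultimately show ?thesis
    by blast
qed

lemma north_step_remove_cells:
  assumes "is_partition \<nu>" "R \<subseteq> removable_rows \<mu> \<nu>"
  shows "north_step (remove_cells \<nu> R) i = north_step \<nu> i - of_bool (i \<in> R)"
  using assms(2) by (auto simp: north_step_def row_remove_cells[OF assms] removable_rows_def)

lemma north_steps_remove_cells:
  assumes "is_partition \<nu>" "R \<subseteq> removable_rows \<mu> \<nu>"
  shows "north_steps (remove_cells \<nu> R) = flip_peaks (north_steps \<nu>) (north_step \<nu> ` R)"
proof -
  have "north_steps (remove_cells \<nu> R) =
      (\<lambda>i. north_step \<nu> i - of_bool (i \<in> R)) ` (- R) \<union> (\<lambda>i. north_step \<nu> i - of_bool (i \<in> R)) ` R"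
    unfolding north_steps_def image_Un[symmetric] by (simp add: north_step_remove_cells[OF assms])
  also have "\<dots> = north_step \<nu> ` (- R) \<union> (\<lambda>t. t - 1) ` north_step \<nu> ` R"
    by (simp add: image_image)
  also have "north_step \<nu> ` (- R) = north_steps \<nu> - north_step \<nu> ` R"
    unfolding north_steps_def Compl_eq_Diff_UNIV
    using inj_north_step[OF assms(1)] by (rule image_set_diff)
  finally show ?thesis
    by (simp add: flip_peaks_def)
qed

lemma skew_contents_remove_cells:
  assumes "is_partition \<nu>" "R \<subseteq> removable_rows \<mu> \<nu>"
  shows "skew_contents \<mu> (remove_cells \<nu> R) - north_step \<nu> ` R =
    skew_contents \<mu> \<nu> - north_step \<nu> ` R"
proof -
  have "t + int i < int (row (remove_cells \<nu> R) i) \<longleftrightarrow> t + int i < int (row \<nu> i)"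
    if "t \<notin> north_step \<nu> ` R" for t i
    using that by (cases "i \<in> R") (auto simp: row_remove_cells[OF assms] north_step_def image_iff)
  then show ?thesis
    by (auto simp: mem_skew_contents)
qed

lemma ungar_kernel_young_interval:
  assumes \<mu>: "is_partition \<mu>"
  shows "ungar_kernel (young_interval \<mu> lam)
    {\<nu>. \<not> has_odd_odd_peak (north_steps \<nu>) (skew_contents \<mu> \<nu>)}"
    (is "ungar_kernel ?L ?G")
  unfolding ungar_kernel_def
proof (intro conjI ballI notI)
  fix \<nu> \<nu>' assume \<nu>: "\<nu> \<in> carrier ?L \<inter> ?G" and \<nu>': "\<nu>' \<in> ?G" and "nontrivial_ungar_move ?L \<nu> \<nu>'"
  then obtain R where R: "R \<subseteq> removable_rows \<mu> \<nu>" "R \<noteq> {}" "\<nu>' = remove_cells \<nu> R"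
    using nontrivial_ungar_move_young_interval[of \<nu> \<mu> lam \<nu>'] by auto
  have part: "is_partition \<nu>"
    using \<nu> by (simp add: carrier_young_interval)
  interpret peak_flip "north_steps \<nu>" "skew_contents \<mu> \<nu>" "north_step \<nu> ` R" "skew_contents \<mu> \<nu>'"
    using R free_peaks_north_steps[OF \<mu> part] skew_contents_remove_cells[OF part R(1)]
    by unfold_locales (auto simp: finite_skew_contents)
  show False
    using has_odd_odd_peak_flip \<nu> \<nu>' R by (auto simp: north_steps_remove_cells[OF part])
next
  fix \<nu> assume "\<nu> \<in> carrier ?L - ?G"
  then have \<nu>: "\<nu> \<in> carrier ?L" "has_odd_odd_peak (north_steps \<nu>) (skew_contents \<mu> \<nu>)"
    and part: "is_partition \<nu>"
    by (simp_all add: carrier_young_interval)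
  obtain T where T: "T \<subseteq> free_peaks (north_steps \<nu>) (skew_contents \<mu> \<nu>)"
    and no_peak: "\<forall>F'. F' - T = skew_contents \<mu> \<nu> - T \<longrightarrow>
      \<not> has_odd_odd_peak (flip_peaks (north_steps \<nu>) T) F'"
    using ex_flip_without_odd_odd_peak[OF finite_skew_contents] by meson
  then obtain R where R: "R \<subseteq> removable_rows \<mu> \<nu>" "T = north_step \<nu> ` R"
    unfolding free_peaks_north_steps[OF \<mu> part] by (auto simp: subset_image_iff)
  have "R \<noteq> {}"
    using no_peak[rule_format, of "skew_contents \<mu> \<nu>"] R(2) \<nu>(2) by auto
  then have "nontrivial_ungar_move ?L \<nu> (remove_cells \<nu> R)"
    using nontrivial_ungar_move_young_interval[OF \<nu>(1)] R(1) by auto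
  moreover have "remove_cells \<nu> R \<in> ?G"
    using no_peak skew_contents_remove_cells[OF part R(1)] R
    by (simp add: north_steps_remove_cells[OF part])
  ultimately show "\<exists>\<nu>'\<in>?G. nontrivial_ungar_move ?L \<nu> \<nu>'"
    by blast
qed

lemma atniss_win_young_interval:
  assumes "is_partition \<mu>" "is_partition lam" "\<mu> \<le>\<^sub>Y lam"
  shows "atniss_win (young_interval \<mu> lam) \<longleftrightarrow>
    has_odd_odd_peak (north_steps lam) (skew_contents \<mu> lam)"
proof -
  note kernel = ungar_kernel_young_interval[OF assms(1), of lam]
  interpret lattice "young_interval \<mu> lam"
    by (rule young_interval_lattice)
  show ?thesis
    using assms(2,3) atniss_win_iff_top_notin_kernel[OF finite_young_interval _ kernel]
    by (simp add: top_young_interval carrier_young_interval young_le_def)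
qed

section \<open>Boundary paths as words\<close>

text \<open>The word is read from vertex \<open>c\<close> on; all steps before it go north, all steps after it east.\<close>

definition word_north_steps :: "int \<Rightarrow> step list \<Rightarrow> int set" where
  "word_north_steps c w = {t. t < c \<or> t < c + int (length w) \<and> w ! nat (t - c) = North}"

lemma mem_word_north_steps:
  "c + int k \<in> word_north_steps c w \<longleftrightarrow> k < length w \<and> w ! k = North"
  by (simp add: word_north_steps_def)

lemma word_north_steps_below: "t < c \<Longrightarrow> t \<in> word_north_steps c w"
  by (simp add: word_north_steps_def)

lemma int_offset_cases [case_names below offset]:
  fixes t c :: int
  obtains "t < c" | k where "t = c + int k"
  by (metis linorder_not_less zle_iff_zadd)

lemma word_north_steps_snoc_North:
  "word_north_steps c (w @ [North]) = insert (c + int (length w)) (word_north_steps c w)"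
  by (auto simp: word_north_steps_def nth_append split: if_splits)

lemma word_north_steps_append_East:
  "word_north_steps c (w @ replicate k East) = word_north_steps c w"
proof (rule Set.set_eqI)
  show "t \<in> word_north_steps c (w @ replicate k East) \<longleftrightarrow> t \<in> word_north_steps c w" for t
    by (cases t c rule: int_offset_cases)
      (auto simp: word_north_steps_below mem_word_north_steps nth_append)
qed

lemma word_north_steps_pred: "word_north_steps (c - 1) w = (\<lambda>t. t - 1) ` word_north_steps c w"
proof (rule Set.set_eqI)
  show "t \<in> word_north_steps (c - 1) w \<longleftrightarrow> t \<in> (\<lambda>t. t - 1) ` word_north_steps c w" for t
  proof (cases t "c - 1" rule: int_offset_cases)
    case (offset k)
    then show ?thesis
      using mem_word_north_steps[of "c - 1" k w] mem_word_north_steps[of c k w]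
      by (simp add: mem_image_pred)
  qed (simp add: mem_image_pred word_north_steps_below)
qed

lemma boundary_path_Cons:
  "boundary_path (a # xs) = boundary_path xs @ replicate (a - row xs 0) East @ [North]"
  by (cases xs) (simp_all add: row_def)

lemma is_partition_ConsD:
  assumes "is_partition (a # xs)"
  shows "is_partition xs" and "row xs 0 \<le> a"
  using assms by (auto simp: is_partition_def row_def)

lemma length_boundary_path: "is_partition lam \<Longrightarrow> length (boundary_path lam) = length lam + row lam 0"
proof (induction lam)
  case (Cons a xs)
  then show ?case
    using is_partition_ConsD[OF Cons.prems] by (simp add: boundary_path_Cons row_def[of "a # xs"])
qed (simp add: row_def)

lemma north_steps_Cons: "north_steps (a # xs) = insert (int a - 1) ((\<lambda>t. t - 1) ` north_steps xs)"
proof -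
  have steps: "north_step (a # xs) 0 = int a - 1"
    "north_step (a # xs) (Suc i) = north_step xs i - 1" for i
    by (simp_all add: north_step_def row_def)
  have "north_step (a # xs) i \<in> insert (int a - 1) ((\<lambda>t. t - 1) ` north_steps xs)" for i
    by (cases i) (simp_all add: steps north_steps_def)
  moreover have "north_step xs i - 1 \<in> north_steps (a # xs)" for i
    unfolding north_steps_def steps(2)[symmetric] by (rule rangeI)
  moreover have "int a - 1 \<in> north_steps (a # xs)"
    unfolding north_steps_def steps(1)[symmetric] by (rule rangeI)
  ultimately show ?thesis
    by (auto simp: north_steps_def)
qed

lemma north_steps_boundary_path:
  "is_partition lam \<Longrightarrow> north_steps lam = word_north_steps (- int (length lam)) (boundary_path lam)"
proof (induction lam)
  case Nil
  have "t \<in> north_steps [] \<longleftrightarrow> t < 0" for t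
  proof
    assume "t < 0"
    then have "t = north_step [] (nat (- t - 1))"
      by (simp add: north_step_def row_def)
    then show "t \<in> north_steps []"
      unfolding north_steps_def by (rule range_eqI)
  qed (auto simp: north_steps_def north_step_def row_def)
  then show ?case
    by (auto simp: word_north_steps_def)
next
  case (Cons a xs)
  note xs = is_partition_ConsD[OF Cons.prems]
  let ?c = "- int (length (a # xs))"
  have "word_north_steps ?c (boundary_path (a # xs)) =
      insert (int a - 1) (word_north_steps ?c (boundary_path xs))"
    using xs(2) length_boundary_path[OF xs(1)]
    by (simp add: boundary_path_Cons word_north_steps_snoc_North word_north_steps_append_East
        flip: append_assoc)
  also have "\<dots> = north_steps (a # xs)"
    using Cons.IH[OF xs(1)] word_north_steps_pred[of "- int (length xs)"]
    by (simp add: north_steps_Cons minus_diff_commute[of 1])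
  finally show ?case ..
qed

lemma split_leading_run:
  obtains n ys where "xs = replicate n x @ ys" "ys = [] \<or> hd ys \<noteq> x"
proof
  have "takeWhile ((=) x) xs = replicate (length (takeWhile ((=) x) xs)) x"
    by (rule replicate_eqI) (auto dest: set_takeWhileD)
  then show "xs = replicate (length (takeWhile ((=) x) xs)) x @ dropWhile ((=) x) xs"
    by (metis takeWhile_dropWhile_id)
  show "dropWhile ((=) x) xs = [] \<or> hd (dropWhile ((=) x) xs) \<noteq> x"
    using hd_dropWhile[of "(=) x" xs] by metis
qed

lemma split_trailing_run:
  obtains ys n where "xs = ys @ replicate n x" "ys = [] \<or> last ys \<noteq> x"
proof -
  obtain n zs where "rev xs = replicate n x @ zs" "zs = [] \<or> hd zs \<noteq> x"
    using split_leading_run .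
  then show ?thesis
    using that[of "rev zs" n] by (simp add: rev_swap last_rev)
qed

context
  fixes c :: int and w :: "step list" and F :: "int set"
  assumes free_north: "\<And>t. t \<in> word_north_steps c w \<Longrightarrow> c \<le> t \<Longrightarrow> t \<in> F"
    and free_east: "\<And>t. t \<notin> word_north_steps c w \<Longrightarrow> t < c + int (length w) \<Longrightarrow> t + 1 \<in> F"
begin

lemma card_east_run_word:
  assumes "take k w = us @ replicate a East" "k \<le> length w" "us = [] \<or> last us \<noteq> East"
  shows "card (east_run (word_north_steps c w) F (c + int k)) = a"
proof -
  let ?N = "word_north_steps c w" and ?l = "length us"
  have k: "k = ?l + a"
    using arg_cong[OF assms(1), of length] assms(2) by simp
  have letter: "w ! j = (us @ replicate a East) ! j" if "j < k" for j
    using that assms(1) by (metis nth_take)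
  have east: "u \<notin> ?N \<and> u + 1 \<in> F" if u: "c + int ?l \<le> u" "u < c + int k" for u
  proof -
    obtain j where j: "u = c + int j" "?l \<le> j" "j < k"
      using u by (cases u c rule: int_offset_cases) auto
    then have "w ! j = East"
      using letter k by (simp add: nth_append)
    then show ?thesis
      using free_east[of u] j assms(2) by (simp add: mem_word_north_steps)
  qed
  have before: "c + int ?l - 1 \<in> ?N"
  proof (cases us rule: rev_cases)
    case Nil
    then show ?thesis
      by (simp add: word_north_steps_below)
  next
    case (snoc vs x)
    then have "w ! length vs = North"
      using letter[of "length vs"] k assms(3) by (cases x) (auto simp: nth_append)
    then show ?thesis
      using mem_word_north_steps[of c "length vs" w] snoc k assms(2) by simp
  qed
  have "east_run ?N F (c + int k) = {c + int ?l..<c + int k}"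
    using k before east by (intro east_run_eq_interval) simp_all
  then show ?thesis
    using k by simp
qed

lemma card_north_run_word:
  assumes "drop k w = replicate b North @ vs" "k \<le> length w" "vs = [] \<or> hd vs \<noteq> North"
  shows "card (north_run (word_north_steps c w) F (c + int k)) = b"
proof -
  let ?N = "word_north_steps c w"
  have len: "length w = k + b + length vs"
    using arg_cong[OF assms(1), of length] assms(2) by simp
  have letter: "w ! (k + j) = (replicate b North @ vs) ! j" for j
    using assms(1,2) by (metis nth_drop)
  have north: "u \<in> ?N \<and> u \<in> F" if u: "c + int k \<le> u" "u < c + int k + int b" for u
  proof -
    obtain j where j: "u = c + int (k + j)" "j < b"
      using u by (cases u "c + int k" rule: int_offset_cases) auto
    then have "u \<in> ?N"
      using letter[of j] len by (simp add: nth_append mem_word_north_steps del: of_nat_add)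
    then show ?thesis
      using free_north j by simp
  qed
  have after: "c + int k + int b \<notin> ?N"
  proof -
    have "w ! (k + b) \<noteq> North" if "k + b < length w"
      using letter[of b] len that assms(3) by (simp add: nth_append hd_conv_nth)
    then show ?thesis
      using mem_word_north_steps[of c "k + b" w] by (auto simp: add.assoc)
  qed
  have "north_run ?N F (c + int k) = {c + int k..<c + int k + int b}"
    using after north by (intro north_run_eq_interval) simp_all
  then show ?thesis
    by simp
qed

lemma has_odd_odd_peak_word:
  assumes "finite F"
  shows "has_odd_odd_peak (word_north_steps c w) F \<longleftrightarrow> has_odd_east_odd_north w"
proof
  let ?N = "word_north_steps c w"
  assume "has_odd_odd_peak ?N F"
  then obtain t where t: "odd_east_run ?N F t" "odd_north_run ?N F t"
    unfolding odd_odd_peak_def by blast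
  have "t - 1 \<notin> ?N" "t \<in> ?N"
    using t odd_east_run_step[OF assms, of ?N "t - 1"] odd_north_run_step[OF assms, of ?N t]
    by simp_all
  then obtain k where k: "t = c + int k" "k \<le> length w"
    by (cases t c rule: int_offset_cases) (auto simp: word_north_steps_below mem_word_north_steps)
  obtain us a where us: "take k w = us @ replicate a East" "us = [] \<or> last us \<noteq> East"
    using split_trailing_run .
  obtain b vs where vs: "drop k w = replicate b North @ vs" "vs = [] \<or> hd vs \<noteq> North"
    using split_leading_run .
  have odd: "odd a" "odd b"
    using t card_east_run_word[OF us(1) k(2) us(2)] card_north_run_word[OF vs(1) k(2) vs(2)]
    by (simp_all add: odd_east_run_def odd_north_run_def k(1))
  then have "is_block us East a (replicate b North @ vs)"
    "is_block (us @ replicate a East) North b vs"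
    using us(2) vs(2) by (auto simp: is_block_def odd_pos)
  moreover have "w = us @ replicate a East @ replicate b North @ vs"
    using us(1) vs(1) append_take_drop_id[of k w] by simp
  ultimately show "has_odd_east_odd_north w"
    unfolding has_odd_east_odd_north_def using odd by blast
next
  assume "has_odd_east_odd_north w"
  then obtain us a b vs where w: "w = us @ replicate a East @ replicate b North @ vs"
    and us: "us = [] \<or> last us \<noteq> East" and vs: "vs = [] \<or> hd vs \<noteq> North" and odd: "odd a" "odd b"
    unfolding has_odd_east_odd_north_def is_block_def by blast
  let ?k = "length us + a"
  have "take ?k w = us @ replicate a East" "drop ?k w = replicate b North @ vs" "?k \<le> length w"
    using w by simp_all
  then have "odd_odd_peak (word_north_steps c w) F (c + int ?k)"
    using card_east_run_word[of ?k us a] card_north_run_word[of ?k b vs] us vs odd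
    by (simp add: odd_odd_peak_def odd_east_run_def odd_north_run_def)
  then show "has_odd_odd_peak (word_north_steps c w) F" ..
qed

end

lemma eeta_win_iff_boundary_path:
  assumes \<mu>: "is_partition \<mu>" and lam: "is_partition lam"
    and no_shared_north: "\<And>i. i < length lam \<Longrightarrow> row \<mu> i < row lam i"
    and no_shared_east: "\<And>i. row \<mu> i \<le> row lam (Suc i)"
  shows "eeta_win (young_interval \<mu> lam) \<longleftrightarrow> \<not> has_odd_east_odd_north (boundary_path lam)"
proof -
  let ?c = "- int (length lam)" and ?w = "boundary_path lam" and ?F = "skew_contents \<mu> lam"
  note steps = north_steps_boundary_path[OF lam]
  have north: "t \<in> ?F" if "t \<in> north_steps lam" "?c \<le> t" for t
  proof -
    obtain i where i: "t = north_step lam i"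
      using \<open>t \<in> north_steps lam\<close> by (auto simp: north_steps_def)
    then have "i < length lam"
      using \<open>?c \<le> t\<close> by (cases "i < length lam") (simp_all add: north_step_def row_def)
    then show ?thesis
      using no_shared_north north_step_mem_skew_contents_iff[OF \<mu> lam] i by simp
  qed
  have east: "t + 1 \<in> ?F" if "t \<notin> north_steps lam" "t < int (row lam 0)" for t
  proof -
    have "north_step lam (length lam + nat (- t)) < t" "\<not> north_step lam 0 < t"
      using \<open>t < int (row lam 0)\<close> by (simp_all add: north_step_def row_def[of lam "length lam + _"])
    then obtain i where "t \<le> north_step lam i" "north_step lam (Suc i) < t"
      using ex_least_nat_less[of "\<lambda>i. north_step lam i < t"] by (metis linorder_not_less order_refl)
    moreover have "t \<noteq> north_step lam i"
      using \<open>t \<notin> north_steps lam\<close> by (auto simp: north_steps_def)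
    ultimately show ?thesis
      using no_shared_east[of i] unfolding mem_skew_contents
      by (intro exI[of _ i]) (simp add: north_step_def)
  qed
  have "has_odd_odd_peak (word_north_steps ?c ?w) ?F \<longleftrightarrow> has_odd_east_odd_north ?w"
    using north east unfolding steps
    by (intro has_odd_odd_peak_word finite_skew_contents)
      (simp_all add: length_boundary_path[OF lam])
  moreover have "\<mu> \<le>\<^sub>Y lam"
    unfolding young_le_row using no_shared_east row_antimono[OF lam] le_trans le_Suc_eq by blast
  ultimately show ?thesis
    by (simp add: eeta_win_def atniss_win_young_interval[OF \<mu> lam] steps)
qed

lemma row_staircase: "row (staircase m) i = m - i"
  by (auto simp: row_def staircase_def rev_nth simp del: upt_Suc)

lemma ex_young_le_staircase:
  assumes "is_partition \<mu>"
  shows "\<exists>m. \<mu> \<le>\<^sub>Y staircase m"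
proof
  show "\<mu> \<le>\<^sub>Y staircase (length \<mu> + row \<mu> 0)"
    unfolding young_le_row
  proof
    fix i
    show "row \<mu> i \<le> row (staircase (length \<mu> + row \<mu> 0)) i"
      using row_antimono[OF assms, of 0 i] row_pos_iff[OF assms, of i]
      by (cases "i < length \<mu>") (auto simp: row_staircase)
  qed
qed

theorem theorem1p5:
  fixes \<mu> lam :: "nat list" and n :: nat
  assumes "is_partition \<mu>" and "is_partition lam" and "\<mu> \<le>\<^sub>Y lam"
    and "n = (LEAST m. \<mu> \<le>\<^sub>Y staircase m)"
    and "staircase (n + 1) \<le>\<^sub>Y lam"
  shows "eeta_win (young_interval \<mu> lam) \<longleftrightarrow> \<not> has_odd_east_odd_north (boundary_path lam)"
proof (rule eeta_win_iff_boundary_path[OF assms(1,2)])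
  have "\<mu> \<le>\<^sub>Y staircase n"
    unfolding assms(4) using ex_young_le_staircase[OF assms(1)] by (rule LeastI_ex)
  then have upper: "row \<mu> i \<le> n - i" for i
    by (simp add: young_le_row row_staircase)
  have lower: "n + 1 - i \<le> row lam i" for i
    using assms(5) by (simp add: young_le_row row_staircase)
  show "row \<mu> i \<le> row lam (Suc i)" for i
    using upper[of i] lower[of "Suc i"] by simp
  show "row \<mu> i < row lam i" if "i < length lam" for i
    using upper[of i] lower[of i] row_pos_iff[OF assms(2), of i] that by linarith
qed

end
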